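(* Let $F(w)=\frac1n\sum_{i=1}^n f_i(w)$ on $\mathbb{R}^d$ be bounded below and $L$-average-smooth. Run the SARAH algorithm (defined in the context) with inner loop size $m$, outer loop size $S$, and learning rate $0<\eta\le \frac{2}{L(\sqrt{1+4m}+1)}$. Then, for any given $\tilde w_0\in\mathbb{R}^d$, $$\frac{1}{(m+1)S}\sum_{s=1}^S\sum_{t=0}^m \mathbb{E}\big[\|\nabla F(w_t^{(s)})\|^2\big]\le \frac{2}{\eta\,[(m+1)S]}\,[F(\tilde w_0)-F^*],$$ where $F^*$ is any lower bound of $F$ and $w_t^{(s)}$ is the $t$-th iterate in the $s$-th outer loop.
   Context: Setting: $f_1,\dots,f_n:\mathbb{R}^d\to\mathbb{R}$ are differentiable and $F=\frac1n\sum_{i=1}^n f_i$ has a finite lower bound. $L$-average-smooth: there is a constant $L>0$ with $\frac1n\sum_{i=1}^n\|\nabla f_i(w)-\nabla f_i(w')\|^2\le L^2\|w-w'\|^2$ for all $w,w'\in\mathbb{R}^d$. SARAH algorithm. Parameters: learning rate $\eta>0$, inner loop size $m$ (an integer $\ge 0$), outer loop size $S$ (an integer $\ge 1$), starting point $\tilde w_0$. For $s=1,\dots,S$: set $w_0^{(s)}=\tilde w_{s-1}$, $v_0^{(s)}=\frac1n\sum_{i=1}^n\nabla f_i(w_0^{(s)})$, $w_1^{(s)}=w_0^{(s)}-\eta v_0^{(s)}$; then for $t=1,\dots,m$ sample $i_t$ uniformly at random from $\{1,\dots,n\}$ (independently of everything before) and set $v_t^{(s)}=\nabla f_{i_t}(w_t^{(s)})-\nabla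 f_{i_t}(w_{t-1}^{(s)})+v_{t-1}^{(s)}$ and $w_{t+1}^{(s)}=w_t^{(s)}-\eta v_t^{(s)}$; finally set $\tilde w_s=w_{m+1}^{(s)}$. $\mathbb{E}$ denotes expectation over all the random samples. *)

theory Defs
  imports "HOL-Probability.Probability"
begin

definition gradient :: "('a::real_inner \<Rightarrow> real) \<Rightarrow> 'a \<Rightarrow> 'a" where
  "gradient h w = (THE D. GDERIV h w :> D)"

definition average_fun :: "nat \<Rightarrow> (nat \<Rightarrow> 'a \<Rightarrow> real) \<Rightarrow> 'a \<Rightarrow> real" where
  "average_fun n f w = (1 / real n) * (\<Sum>i = 1..n. f i w)"

definition average_smooth :: "nat \<Rightarrow> (nat \<Rightarrow> 'a::real_inner \<Rightarrow> real) \<Rightarrow> real \<Rightarrow> bool" where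
  "average_smooth n f L \<longleftrightarrow>
     0 < L \<and>
     (\<forall>w w'. (1 / real n) * (\<Sum>i = 1..n. (norm (gradient (f i) w - gradient (f i) w'))\<^sup>2)
              \<le> L\<^sup>2 * (norm (w - w'))\<^sup>2)"

text \<open>
  One inner loop started at \<open>w0\<close>, along a fixed sequence of sampled indices \<open>i 1, i 2, \<dots>\<close>:
  \<open>sarah_w\<close> is the iterate and \<open>sarah_v\<close> the recursive gradient estimator.
\<close>

fun sarah_w :: "nat \<Rightarrow> (nat \<Rightarrow> 'a::real_inner \<Rightarrow> real) \<Rightarrow> real \<Rightarrow> 'a \<Rightarrow> (nat \<Rightarrow> nat) \<Rightarrow> nat \<Rightarrow> 'a"
  and sarah_v :: "nat \<Rightarrow> (nat \<Rightarrow> 'a::real_inner \<Rightarrow> real) \<Rightarrow> real \<Rightarrow> 'a \<Rightarrow> (nat \<Rightarrow> nat) \<Rightarrow> nat \<Rightarrow> 'a"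
where
  "sarah_w n f \<eta> w0 i 0 = w0"
| "sarah_w n f \<eta> w0 i (Suc t) = sarah_w n f \<eta> w0 i t - \<eta> *\<^sub>R sarah_v n f \<eta> w0 i t"
| "sarah_v n f \<eta> w0 i 0 = (1 / real n) *\<^sub>R (\<Sum>j = 1..n. gradient (f j) w0)"
| "sarah_v n f \<eta> w0 i (Suc t) =
     gradient (f (i (Suc t))) (sarah_w n f \<eta> w0 i (Suc t))
     - gradient (f (i (Suc t))) (sarah_w n f \<eta> w0 i t)
     + sarah_v n f \<eta> w0 i t"

text \<open>
  Here \<open>i s t\<close> is the index sampled at inner step \<open>t\<close> of outer loop \<open>s\<close>. Outer loop \<open>s \<ge> 1\<close>
  starts at \<open>sarah_outer \<dots> (s - 1)\<close> and consumes the samples \<open>i s 1, \<dots>, i s m\<close>; computing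
  the last iterate \<open>w (m + 1)\<close> needs no further sample.
\<close>

fun sarah_outer ::
  "nat \<Rightarrow> (nat \<Rightarrow> 'a::real_inner \<Rightarrow> real) \<Rightarrow> real \<Rightarrow> nat \<Rightarrow> 'a \<Rightarrow> (nat \<Rightarrow> nat \<Rightarrow> nat) \<Rightarrow> nat \<Rightarrow> 'a"
where
  "sarah_outer n f \<eta> m w0 i 0 = w0"
| "sarah_outer n f \<eta> m w0 i (Suc s) =
     sarah_w n f \<eta> (sarah_outer n f \<eta> m w0 i s) (i (Suc s)) (m + 1)"

text \<open>The \<open>t\<close>-th iterate of the \<open>s\<close>-th outer loop; meaningful for \<open>s \<ge> 1\<close>.\<close>

definition sarah_iterate ::
  "nat \<Rightarrow> (nat \<Rightarrow> 'a::real_inner \<Rightarrow> real) \<Rightarrow> real \<Rightarrow> nat \<Rightarrow> 'a \<Rightarrow> (nat \<Rightarrow> nat \<Rightarrow> nat) \<Rightarrow> nat \<Rightarrow> nat \<Rightarrow> 'a"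
where
  "sarah_iterate n f \<eta> m w0 i s t = sarah_w n f \<eta> (sarah_outer n f \<eta> m w0 i (s - 1)) (i s) t"

end

theory Submission
  imports Defs
begin

text \<open>
  The iterates depend on finitely many independent uniform samples, so every expectation is an
  average over the finite set of sample tables, and conditioning on the past becomes the remark that
  averaging a single entry of the table over all its values does not change the total average.

  By Jensen's inequality \<open>\<nabla>F\<close> is \<open>L\<close>-Lipschitz, so a step \<open>w - \<eta> v\<close> decreases \<open>F\<close> by at least
  \<open>\<eta>/2 \<parallel>\<nabla>F w\<parallel>\<^sup>2 - \<eta>/2 \<parallel>\<nabla>F w - v\<parallel>\<^sup>2 + \<eta>/2 (1 - L \<eta>) \<parallel>v\<parallel>\<^sup>2\<close>. Averaging over the sample used in step
  \<open>t + 1\<close>, the estimator error \<open>\<parallel>\<nabla>F w - v\<parallel>\<^sup>2\<close>, which vanishes for \<open>t = 0\<close>, grows by at most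
  \<open>L\<^sup>2 \<eta>\<^sup>2 \<parallel>v\<parallel>\<^sup>2\<close>, so the errors of an inner loop add up to at most \<open>L\<^sup>2 \<eta>\<^sup>2 m \<Sum>\<^sub>t \<parallel>v\<parallel>\<^sup>2\<close>. The step size
  condition says exactly \<open>L\<^sup>2 \<eta>\<^sup>2 m + L \<eta> \<le> 1\<close>, so the error is absorbed by the last term of the descent
  inequality, and summing over all steps telescopes.
\<close>

subsection \<open>Gradients\<close>

text \<open>Riesz representation: the values of the derivative on \<open>Basis\<close> are the
  coordinates of the gradient. Uniqueness is proved too, because \<open>gradient\<close> is a
  definite description.\<close>

lemma GDERIV_gradient:
  fixes h :: "'a::euclidean_space \<Rightarrow> real"
  assumes "h differentiable (at w)"
  shows "GDERIV h w :> gradient h w"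
proof -
  obtain h' where h': "(h has_derivative h') (at w)"
    using assms by (auto simp: differentiable_def)
  then interpret bounded_linear h'
    by (rule has_derivative_bounded_linear)
  let ?D = "\<Sum>b\<in>Basis. h' b *\<^sub>R b"
  have "h' = (\<lambda>x. x \<bullet> ?D)"
  proof
    fix x
    have "h' x = h' (\<Sum>b\<in>Basis. (x \<bullet> b) *\<^sub>R b)"
      by (simp add: euclidean_representation)
    also have "\<dots> = x \<bullet> ?D"
      by (simp add: sum scaleR inner_sum_right mult.commute)
    finally show "h' x = x \<bullet> ?D" .
  qed
  with h' have D: "GDERIV h w :> ?D"
    by (simp add: gderiv_def)
  moreover have "E = ?D" if "GDERIV h w :> E" for E
  proof -
    have "(\<lambda>x. x \<bullet> E) = (\<lambda>x. x \<bullet> ?D)"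
      using that D unfolding gderiv_def by (rule has_derivative_unique)
    then have "\<forall>x. x \<bullet> E = x \<bullet> ?D"
      by meson
    then show ?thesis
      by (rule iffD1[OF vector_eq_ldot])
  qed
  ultimately show ?thesis
    unfolding gradient_def by (rule theI)
qed

lemma gradient_eqI:
  fixes h :: "'a::euclidean_space \<Rightarrow> real"
  assumes "GDERIV h w :> D"
  shows "gradient h w = D"
proof -
  have "h differentiable (at w)"
    using assms by (auto simp: gderiv_def differentiable_def)
  then have "(\<lambda>x. x \<bullet> gradient h w) = (\<lambda>x. x \<bullet> D)"
    using assms GDERIV_gradient unfolding gderiv_def by (blast intro: has_derivative_unique)
  then have "\<forall>x. x \<bullet> gradient h w = x \<bullet> D"
    by meson
  then show ?thesis
    by (rule iffD1[OF vector_eq_ldot])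
qed

lemma descent_lemma:
  fixes h :: "'a::euclidean_space \<Rightarrow> real"
  assumes "\<And>w. h differentiable (at w)"
    and "\<And>w w'. norm (gradient h w - gradient h w') \<le> L * norm (w - w')"
  shows "h (w + d) \<le> h w + gradient h w \<bullet> d + L / 2 * (norm d)\<^sup>2"
proof -
  \<comment> \<open>Subtracting the linear and quadratic terms of the bound along the segment turns
    the claim into \<open>\<phi> 1 \<le> \<phi> 0\<close>, so the sign of a derivative suffices and
    no integral appears.\<close>
  define \<phi> where "\<phi> \<tau> = h (w + \<tau> *\<^sub>R d) - \<tau> * (gradient h w \<bullet> d) - L / 2 * \<tau>\<^sup>2 * (norm d)\<^sup>2" for \<tau>
  have "\<phi> 1 \<le> \<phi> 0"
  proof (rule DERIV_nonpos_imp_nonincreasing[of 0 1 \<phi>])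
    fix \<tau> :: real
    assume \<tau>: "0 \<le> \<tau>" "\<tau> \<le> 1"
    let ?D = "d \<bullet> gradient h (w + \<tau> *\<^sub>R d) - gradient h w \<bullet> d - L * \<tau> * (norm d)\<^sup>2"
    have h: "(h has_derivative (\<lambda>x. x \<bullet> gradient h (w + \<tau> *\<^sub>R d))) (at (w + \<tau> *\<^sub>R d))"
      using GDERIV_gradient[OF assms(1)] by (simp add: gderiv_def)
    have "((\<lambda>\<tau>. w + \<tau> *\<^sub>R d) has_derivative (\<lambda>x. x *\<^sub>R d)) (at \<tau>)"
      by (auto intro!: derivative_eq_intros)
    from has_derivative_compose[OF this h]
    have [derivative_intros]:
      "((\<lambda>\<tau>. h (w + \<tau> *\<^sub>R d)) has_real_derivative (d \<bullet> gradient h (w + \<tau> *\<^sub>R d))) (at \<tau>)"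
      by (simp add: has_field_derivative_def mult_commute_abs)
    have "(\<phi> has_real_derivative ?D) (at \<tau>)"
      unfolding \<phi>_def by (auto intro!: derivative_eq_intros)
    moreover have "?D \<le> 0"
    proof -
      have "d \<bullet> (gradient h (w + \<tau> *\<^sub>R d) - gradient h w)
          \<le> norm d * norm (gradient h (w + \<tau> *\<^sub>R d) - gradient h w)"
        by (rule norm_cauchy_schwarz)
      also have "\<dots> \<le> norm d * (L * norm (\<tau> *\<^sub>R d))"
        using assms(2)[of "w + \<tau> *\<^sub>R d" w] by (intro mult_left_mono) auto
      finally show ?thesis
        using \<tau> by (simp add: inner_diff_right inner_commute power2_eq_square algebra_simps)
    qed
    ultimately show "\<exists>y. (\<phi> has_real_derivative y) (at \<tau>) \<and> y \<le> 0"
      by blast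
  qed simp
  then show ?thesis
    by (simp add: \<phi>_def)
qed

subsection \<open>Finite means\<close>

text \<open>Division by zero makes the mean 0 on an empty or infinite set, so monotonicity and
  linearity hold without side conditions.\<close>

definition mean :: "'i set \<Rightarrow> ('i \<Rightarrow> real) \<Rightarrow> real" where
  "mean A \<Phi> = (\<Sum>x\<in>A. \<Phi> x) / real (card A)"

lemma mean_mono: "(\<And>x. x \<in> A \<Longrightarrow> \<Phi> x \<le> \<Psi> x) \<Longrightarrow> mean A \<Phi> \<le> mean A \<Psi>"
  by (simp add: mean_def divide_right_mono sum_mono)

lemma mean_add: "mean A (\<lambda>x. \<Phi> x + \<Psi> x) = mean A \<Phi> + mean A \<Psi>"
  by (simp add: mean_def sum.distrib add_divide_distrib)

lemma mean_diff: "mean A (\<lambda>x. \<Phi> x - \<Psi> x) = mean A \<Phi> - mean A \<Psi>"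
  by (simp add: mean_def sum_subtractf diff_divide_distrib)

lemma mean_cmult: "mean A (\<lambda>x. c * \<Phi> x) = c * mean A \<Phi>"
  by (simp add: mean_def sum_distrib_left)

lemma mean_const: "finite A \<Longrightarrow> A \<noteq> {} \<Longrightarrow> mean A (\<lambda>x. c) = c"
  by (simp add: mean_def)

lemma mean_nonneg: "(\<And>x. x \<in> A \<Longrightarrow> 0 \<le> \<Phi> x) \<Longrightarrow> 0 \<le> mean A \<Phi>"
  by (simp add: mean_def sum_nonneg)

text \<open>Bias-variance identity: after expanding the square, the cross term sees \<open>d\<close>
  only through its mean. Taking \<open>b = dbar\<close> yields Jensen's inequality; another choice
  of \<open>b\<close> yields the recursion for the estimator error.\<close>

lemma mean_norm_diff_square:
  fixes d :: "'i \<Rightarrow> 'a::real_inner"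
  assumes "finite A" "A \<noteq> {}" and dbar: "dbar = (1 / real (card A)) *\<^sub>R (\<Sum>j\<in>A. d j)"
  shows "mean A (\<lambda>j. (norm (b - d j))\<^sup>2)
    = (norm (b - dbar))\<^sup>2 - (norm dbar)\<^sup>2 + mean A (\<lambda>j. (norm (d j))\<^sup>2)"
proof -
  have "(\<lambda>j. (norm (b - d j))\<^sup>2) = (\<lambda>j. (norm b)\<^sup>2 - 2 * (b \<bullet> d j) + (norm (d j))\<^sup>2)"
    by (simp add: power2_norm_eq_inner inner_diff inner_commute algebra_simps)
  moreover have "mean A (\<lambda>j. b \<bullet> d j) = b \<bullet> dbar"
    by (simp add: mean_def dbar inner_sum_right)
  ultimately have "mean A (\<lambda>j. (norm (b - d j))\<^sup>2)
      = (norm b)\<^sup>2 - 2 * (b \<bullet> dbar) + mean A (\<lambda>j. (norm (d j))\<^sup>2)"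
    using assms(1,2) by (simp add: mean_add mean_diff mean_cmult mean_const)
  then show ?thesis
    by (simp add: power2_norm_eq_inner inner_diff inner_commute)
qed

text \<open>A finite tower property. Exchanging the entry at \<open>k\<close> with the fresh value
  \<open>j\<close> is an involution on pairs of a table and a value, and it carries one double sum
  to the other.\<close>

lemma mean_PiE_resample:
  assumes "finite K" "finite A" "A \<noteq> {}" "k \<in> K"
  shows "mean (PiE K (\<lambda>_. A)) (\<lambda>x. mean A (\<lambda>j. \<Phi> (x(k := j)))) = mean (PiE K (\<lambda>_. A)) \<Phi>"
proof -
  let ?X = "PiE K (\<lambda>_. A)"
  have upd: "x(k := j) \<in> ?X" if "x \<in> ?X" "j \<in> A" for x j
    using PiE_fun_upd[of j "\<lambda>_. A" k x K] that \<open>k \<in> K\<close> by (simp add: insert_absorb)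
  have "(\<Sum>x\<in>?X. \<Sum>j\<in>A. \<Phi> (x(k := j))) = (\<Sum>(x, j)\<in>?X \<times> A. \<Phi> (x(k := j)))"
    by (simp add: sum.cartesian_product)
  also have "\<dots> = (\<Sum>(x, j)\<in>?X \<times> A. \<Phi> x)"
    using \<open>k \<in> K\<close>
    by (intro sum.reindex_bij_witness
          [where i = "\<lambda>(x, j). (x(k := j), x k)" and j = "\<lambda>(x, j). (x(k := j), x k)"])
       (auto intro!: upd simp: PiE_mem fun_upd_same simp del: fun_upd_apply PiE_iff)
  also have "\<dots> = real (card A) * (\<Sum>x\<in>?X. \<Phi> x)"
    by (simp add: sum.cartesian_product[symmetric] sum_distrib_left)
  finally show ?thesis
    using assms by (simp add: mean_def sum_divide_distrib[symmetric])
qed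

text \<open>The passage from measure theory to counting: independence and uniformity give all tables
  over \<open>A\<close> the same probability.\<close>

lemma expectation_indep_uniform:
  assumes "prob_space M" and "finite K" and "finite A" and "A \<noteq> {}"
    and ind: "prob_space.indep_vars M (\<lambda>_. count_space UNIV) X K"
    and unif: "\<And>k. k \<in> K \<Longrightarrow> distr M (count_space UNIV) (X k) = measure_pmf (pmf_of_set A)"
  shows "prob_space.expectation M (\<lambda>\<omega>. \<Phi> (\<lambda>k\<in>K. X k \<omega> :: 'c::countable)) = mean (PiE K (\<lambda>_. A)) \<Phi>"
proof -
  interpret prob_space M by fact
  let ?Y = "\<lambda>\<omega>. \<lambda>k\<in>K. X k \<omega>" and ?P = "PiE K (\<lambda>_. A)"
  let ?E = "\<lambda>x. {\<omega> \<in> space M. \<forall>k\<in>K. X k \<omega> = x k}"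
  have fin: "finite ?P"
    using assms by (simp add: finite_PiE)
  have X [measurable]: "X k \<in> measurable M (count_space UNIV)" if "k \<in> K" for k
    using ind that by (auto simp: indep_vars_def)
  have E [measurable]: "?E x \<in> sets M" for x
    using \<open>finite K\<close> by (intro sets.sets_Collect_finite_All) auto
  \<comment> \<open>Samples may leave \<open>A\<close> on a null set, so the table first lives in
    the larger set of all tables on \<open>K\<close>. That set is countable, hence singletons decide
    measurability.\<close>
  have Y: "?Y \<in> measurable M (count_space (PiE K (\<lambda>_. UNIV)))"
  proof (subst measurable_count_space_eq_countable)
    show "countable (PiE K (\<lambda>_. UNIV :: 'c set))"
      using \<open>finite K\<close> by (intro countable_PiE) auto
    have "?Y -` {x} \<inter> space M = ?E x" if "x \<in> PiE K (\<lambda>_. UNIV)" for x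
      using that by (auto simp: fun_eq_iff PiE_def extensional_def)
    then show "?Y \<in> space M \<rightarrow> PiE K (\<lambda>_. UNIV) \<and>
        (\<forall>x\<in>PiE K (\<lambda>_. UNIV). ?Y -` {x} \<inter> space M \<in> sets M)"
      by auto
  qed
  have "\<Phi> \<in> measurable (count_space (PiE K (\<lambda>_. UNIV))) borel"
    by simp
  from measurable_compose[OF Y this]
  have m: "(\<lambda>\<omega>. \<Phi> (?Y \<omega>)) \<in> borel_measurable M" .
  have "AE \<omega> in M. \<forall>k\<in>K. X k \<omega> \<in> A"
  proof (rule AE_finite_allI[OF \<open>finite K\<close>])
    fix k assume k: "k \<in> K"
    have "AE j in measure_pmf (pmf_of_set A). j \<in> A"
      using assms(3,4) by (simp add: AE_measure_pmf_iff)
    then have "AE j in distr M (count_space UNIV) (X k). j \<in> A"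
      by (subst unif[OF k])
    then show "AE \<omega> in M. X k \<omega> \<in> A"
      using X[OF k] by (subst (asm) AE_distr_iff) auto
  qed
  \<comment> \<open>Almost surely the table lies in \<open>?P\<close>, and then exactly one of the
    events \<open>?E x\<close> occurs.\<close>
  then have "AE \<omega> in M. \<Phi> (?Y \<omega>) = (\<Sum>x\<in>?P. indicator (?E x) \<omega> * \<Phi> x)"
    using AE_space
  proof eventually_elim
    case (elim \<omega>)
    have "(\<Sum>x\<in>?P. indicator (?E x) \<omega> * \<Phi> x) = (\<Sum>x\<in>?P. if x = ?Y \<omega> then \<Phi> x else 0)"
    proof (rule sum.cong)
      fix x assume "x \<in> ?P"
      then have "\<omega> \<in> ?E x \<longleftrightarrow> x = ?Y \<omega>"
        using elim by (auto simp: fun_eq_iff PiE_def extensional_def)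
      then show "indicator (?E x) \<omega> * \<Phi> x = (if x = ?Y \<omega> then \<Phi> x else 0)"
        by (simp add: indicator_def)
    qed simp
    then show ?case
      using elim fin by (auto simp: sum.delta)
  qed
  then have "expectation (\<lambda>\<omega>. \<Phi> (?Y \<omega>)) = expectation (\<lambda>\<omega>. \<Sum>x\<in>?P. indicator (?E x) \<omega> * \<Phi> x)"
    using m by (intro integral_cong_AE) auto
  also have "\<dots> = (\<Sum>x\<in>?P. prob (?E x) * \<Phi> x)"
    by (subst Bochner_Integration.integral_sum)
       (auto intro!: integrable_mult_left integrable_real_indicator simp: emeasure_eq_measure)
  also have "\<dots> = (\<Sum>x\<in>?P. \<Phi> x / real (card ?P))"
  proof (rule sum.cong)
    fix x assume x: "x \<in> ?P"
    have "prob (?E x) = (1 / real (card A)) ^ card K"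
    \<comment> \<open>An inner loop of size 0 draws no samples, so \<open>K\<close> may be empty,
      while the product rule for independent events asks for a nonempty index set.\<close>
    proof (cases "K = {}")
      case True
      then show ?thesis by (simp add: prob_space)
    next
      case False
      have "?E x = (\<Inter>k\<in>K. X k -` {x k} \<inter> space M)"
        using False by auto
      also have "prob \<dots> = (\<Prod>k\<in>K. prob (X k -` {x k} \<inter> space M))"
        using ind False \<open>finite K\<close> by (rule indep_varsD_finite) auto
      also have "\<dots> = (\<Prod>k\<in>K. 1 / real (card A))"
      proof (rule prod.cong)
        fix k assume k: "k \<in> K"
        have "prob (X k -` {x k} \<inter> space M) = measure (distr M (count_space UNIV) (X k)) {x k}"
          using X[OF k] by (simp add: measure_distr)
        also have "\<dots> = 1 / real (card A)"
          using assms(3,4) PiE_mem[OF x k] by (simp add: unif[OF k] measure_pmf_single)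
        finally show "prob (X k -` {x k} \<inter> space M) = 1 / real (card A)" .
      qed simp
      finally show ?thesis by simp
    qed
    then show "prob (?E x) * \<Phi> x = \<Phi> x / real (card ?P)"
      using \<open>finite K\<close> by (simp add: card_PiE power_divide)
  qed simp
  finally show ?thesis
    by (simp add: mean_def sum_divide_distrib)
qed

subsection \<open>One inner loop\<close>

text \<open>The strict bound for \<open>sarah_w\<close> against the weak one for
  \<open>sarah_v\<close> matters: iterate \<open>t + 1\<close> is fixed before sample
  \<open>t + 1\<close> is drawn. Entry 0 is never read, so tables indexed from 1 suffice.\<close>

lemma sarah_cong:
  shows sarah_w_cong: "(\<And>r. 1 \<le> r \<Longrightarrow> r < t \<Longrightarrow> i r = i' r) \<Longrightarrow>
      sarah_w n f \<eta> w0 i t = sarah_w n f \<eta> w0 i' t"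
    and sarah_v_cong: "(\<And>r. 1 \<le> r \<Longrightarrow> r \<le> t \<Longrightarrow> i r = i' r) \<Longrightarrow>
      sarah_v n f \<eta> w0 i t = sarah_v n f \<eta> w0 i' t"
proof (induction t)
  case 0
  case 1
  show ?case by simp
next
  case 0
  case 2
  show ?case by simp
next
  case (Suc t)
  case 1
  then show ?case using Suc by simp
next
  case (Suc t)
  case 2
  then have "sarah_w n f \<eta> w0 i (Suc t) = sarah_w n f \<eta> w0 i' (Suc t)"
    "sarah_w n f \<eta> w0 i t = sarah_w n f \<eta> w0 i' t"
    "sarah_v n f \<eta> w0 i t = sarah_v n f \<eta> w0 i' t"
    using Suc by simp_all
  then show ?case using 2 by (simp del: sarah_w.simps(2))
qed

lemma sarah_outer_cong:
  assumes "\<And>r t. 1 \<le> r \<Longrightarrow> r \<le> s \<Longrightarrow> 1 \<le> t \<Longrightarrow> t \<le> m \<Longrightarrow> i r t = i' r t"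
  shows "sarah_outer n f \<eta> m w0 i s = sarah_outer n f \<eta> m w0 i' s"
  using assms
proof (induction s)
  case (Suc s)
  have "sarah_outer n f \<eta> m w0 i s = sarah_outer n f \<eta> m w0 i' s"
    using Suc by simp
  moreover have "sarah_w n f \<eta> u (i (Suc s)) (m + 1) = sarah_w n f \<eta> u (i' (Suc s)) (m + 1)" for u
    using Suc.prems by (intro sarah_w_cong) auto
  ultimately show ?case
    by (simp del: sarah_w.simps)
qed simp

text \<open>With \<open>q = sqrt (1 + 4 * k)\<close>, the value \<open>2 / (q + 1)\<close> is the
  positive solution of \<open>k * y\<^sup>2 + y = 1\<close>, also for \<open>k = 0\<close>, and the
  left side increases for nonnegative \<open>y\<close>.\<close>

lemma sarah_step_size:
  fixes L \<eta> k :: real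
  assumes "0 < L" "0 < \<eta>" "0 \<le> k" "\<eta> \<le> 2 / (L * (sqrt (1 + 4 * k) + 1))"
  shows "L\<^sup>2 * \<eta>\<^sup>2 * k + L * \<eta> \<le> 1"
proof -
  define q where "q = sqrt (1 + 4 * k)"
  have q: "q\<^sup>2 = 1 + 4 * k" "q \<ge> 1"
    using assms by (simp_all add: q_def)
  have y: "0 < L * \<eta>" "L * \<eta> \<le> 2 / (q + 1)"
    using assms mult_left_mono[of \<eta> "2 / (L * (q + 1))" L]
    by (simp_all add: q_def[symmetric])
  then have "(L * \<eta>)\<^sup>2 \<le> (2 / (q + 1))\<^sup>2"
    by (intro power_mono) auto
  then have "(L * \<eta>)\<^sup>2 * k \<le> (2 / (q + 1))\<^sup>2 * k"
    using \<open>0 \<le> k\<close> by (rule mult_right_mono)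
  also have "\<dots> = (2 / (q + 1))\<^sup>2 * ((q\<^sup>2 - 1) / 4)"
    using q by simp
  also have "\<dots> = (q - 1) / (q + 1)"
    using q by (simp add: divide_simps power2_eq_square) (simp add: algebra_simps)
  finally have "(L * \<eta>)\<^sup>2 * k + L * \<eta> \<le> (q - 1) / (q + 1) + 2 / (q + 1)"
    using y by linarith
  also have "\<dots> = 1"
    using q by (simp add: add_divide_distrib[symmetric])
  finally show ?thesis
    by (simp add: power_mult_distrib)
qed

section \<open>Descent and estimator error for average-smooth finite sums\<close>

locale average_smooth_functions =
  fixes n :: nat and f :: "nat \<Rightarrow> 'a::euclidean_space \<Rightarrow> real" and L :: real
  assumes n_pos: "1 \<le> n"
    and differentiable: "i \<in> {1..n} \<Longrightarrow> f i differentiable (at w)"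
    and smooth: "average_smooth n f L"
begin

abbreviation "F \<equiv> average_fun n f"
abbreviation "G \<equiv> gradient F"

lemma L_pos: "0 < L"
  using smooth by (simp add: average_smooth_def)

lemma GDERIV_average: "GDERIV F w :> (1 / real n) *\<^sub>R (\<Sum>i = 1..n. gradient (f i) w)"
proof -
  have "(f i has_derivative (\<lambda>h. h \<bullet> gradient (f i) w)) (at w)" if "i \<in> {1..n}" for i
    using GDERIV_gradient[OF differentiable[OF that]] by (simp add: gderiv_def)
  then have "(F has_derivative (\<lambda>h. (1 / real n) * (\<Sum>i = 1..n. h \<bullet> gradient (f i) w))) (at w)"
    unfolding average_fun_def[abs_def] by (intro has_derivative_mult_right has_derivative_sum)
  then show ?thesis
    by (simp add: gderiv_def inner_sum_right)
qed

lemma gradient_average: "G w = (1 / real n) *\<^sub>R (\<Sum>i = 1..n. gradient (f i) w)"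
  by (rule gradient_eqI[OF GDERIV_average])

lemma gradient_average_diff:
  "G w - G w' = (1 / real (card {1..n})) *\<^sub>R (\<Sum>i = 1..n. gradient (f i) w - gradient (f i) w')"
  by (simp add: gradient_average sum_subtractf scaleR_diff_right)

lemma mean_gradient_diff:
  "mean {1..n} (\<lambda>i. (norm (gradient (f i) w - gradient (f i) w'))\<^sup>2) \<le> L\<^sup>2 * (norm (w - w'))\<^sup>2"
  using smooth by (simp add: average_smooth_def mean_def)

text \<open>The variance of the gradient differences is nonnegative, so the squared norm of their
  mean is at most their mean squared norm, which average smoothness bounds.\<close>

lemma gradient_average_lipschitz: "norm (G w - G w') \<le> L * norm (w - w')"
proof (rule power2_le_imp_le)
  let ?d = "\<lambda>i. gradient (f i) w - gradient (f i) w'"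
  have "0 \<le> mean {1..n} (\<lambda>i. (norm (G w - G w' - ?d i))\<^sup>2)"
    by (rule mean_nonneg) simp
  also have "\<dots> = mean {1..n} (\<lambda>i. (norm (?d i))\<^sup>2) - (norm (G w - G w'))\<^sup>2"
    using n_pos by (subst mean_norm_diff_square[OF _ _ gradient_average_diff]) auto
  finally show "(norm (G w - G w'))\<^sup>2 \<le> (L * norm (w - w'))\<^sup>2"
    using mean_gradient_diff[of w w'] by (simp add: power_mult_distrib)
qed (use L_pos in simp)

lemma differentiable_average: "F differentiable (at w)"
  unfolding differentiable_def by (rule exI, rule GDERIV_average[unfolded gderiv_def])

lemma step_descent:
  "F (w - \<eta> *\<^sub>R v) \<le> F w - \<eta> / 2 * (norm (G w))\<^sup>2 + \<eta> / 2 * (norm (G w - v))\<^sup>2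
     - \<eta> / 2 * (1 - L * \<eta>) * (norm v)\<^sup>2"
proof -
  have rearrange: "a - \<eta> * ((b + c - d) / 2) + L / 2 * (\<eta>\<^sup>2 * c)
      = a - \<eta> / 2 * b + \<eta> / 2 * d - \<eta> / 2 * (1 - L * \<eta>) * c" for a b c d :: real
    by (simp add: field_simps power2_eq_square)
  have "F (w + (- \<eta> *\<^sub>R v)) \<le> F w + G w \<bullet> (- \<eta> *\<^sub>R v) + L / 2 * (norm (- \<eta> *\<^sub>R v))\<^sup>2"
    by (intro descent_lemma differentiable_average gradient_average_lipschitz)
  \<comment> \<open>Polarization replaces the inner product by three squares, one of which is the
    estimator error.\<close>
  moreover have "G w \<bullet> v = ((norm (G w))\<^sup>2 + (norm v)\<^sup>2 - (norm (G w - v))\<^sup>2) / 2"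
    by (simp add: power2_norm_eq_inner inner_diff inner_commute)
  ultimately have "F (w - \<eta> *\<^sub>R v) \<le> F w
      - \<eta> * (((norm (G w))\<^sup>2 + (norm v)\<^sup>2 - (norm (G w - v))\<^sup>2) / 2) + L / 2 * (\<eta>\<^sup>2 * (norm v)\<^sup>2)"
    by (simp add: power_mult_distrib)
  also have "\<dots> = F w - \<eta> / 2 * (norm (G w))\<^sup>2 + \<eta> / 2 * (norm (G w - v))\<^sup>2
      - \<eta> / 2 * (1 - L * \<eta>) * (norm v)\<^sup>2"
    by (rule rearrange)
  finally show ?thesis .
qed

text \<open>The correction averages to \<open>G w' - G w\<close>, so the new error has mean
  \<open>G w - v\<close>, the old error. What is added is the variance of the correction, at most
  its second moment.\<close>

lemma mean_estimator_error:
  "mean {1..n} (\<lambda>j. (norm (G w' - (gradient (f j) w' - gradient (f j) w + v)))\<^sup>2)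
     \<le> (norm (G w - v))\<^sup>2 + L\<^sup>2 * (norm (w' - w))\<^sup>2"
proof -
  let ?d = "\<lambda>j. gradient (f j) w' - gradient (f j) w"
  have cancel: "G w' - v - (G w' - G w) = G w - v"
    by simp
  have "G w' - (?d j + v) = G w' - v - ?d j" for j
    by (rule diff_add_eq_diff_diff_swap)
  then have "mean {1..n} (\<lambda>j. (norm (G w' - (?d j + v)))\<^sup>2)
      = mean {1..n} (\<lambda>j. (norm (G w' - v - ?d j))\<^sup>2)"
    by (simp only:)
  also have "\<dots> = (norm (G w' - v - (G w' - G w)))\<^sup>2 - (norm (G w' - G w))\<^sup>2
      + mean {1..n} (\<lambda>j. (norm (?d j))\<^sup>2)"
    using n_pos by (intro mean_norm_diff_square[OF _ _ gradient_average_diff]) auto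
  also have "\<dots> \<le> (norm (G w - v))\<^sup>2 + L\<^sup>2 * (norm (w' - w))\<^sup>2"
    unfolding cancel using mean_gradient_diff[of w' w] zero_le_power2[of "norm (G w' - G w)"]
    by linarith
  finally show ?thesis .
qed

text \<open>
  The starting point \<open>u x\<close> is random too, but independent of the samples \<open>x (s, 1), \<dots>, x (s, m)\<close>.
\<close>

lemma sarah_inner_loop:
  assumes "finite K" and s: "\<And>t. t \<in> {1..m} \<Longrightarrow> (s, t) \<in> K"
    and u: "\<And>x t j. t \<in> {1..m} \<Longrightarrow> u (x((s, t) := j)) = u x"
    and "0 < \<eta>" and "L\<^sup>2 * \<eta>\<^sup>2 * real m + L * \<eta> \<le> 1"
  defines "E \<equiv> mean (PiE K (\<lambda>_. {1..n}))"
    and "W \<equiv> \<lambda>t x. sarah_w n f \<eta> (u x) (\<lambda>r. x (s, r)) t"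
  shows "E (\<lambda>x. F (W (m + 1) x))
    \<le> E (\<lambda>x. F (u x)) - \<eta> / 2 * (\<Sum>t = 0..m. E (\<lambda>x. (norm (G (W t x)))\<^sup>2))"
proof -
  define V where "V t x = sarah_v n f \<eta> (u x) (\<lambda>r. x (s, r)) t" for t x
  define e where "e t = E (\<lambda>x. (norm (G (W t x) - V t x))\<^sup>2)" for t
  define c where "c t = E (\<lambda>x. (norm (V t x))\<^sup>2)" for t
  define g where "g t = E (\<lambda>x. (norm (G (W t x)))\<^sup>2)" for t
  have W_Suc: "W (Suc t) x = W t x - \<eta> *\<^sub>R V t x" for t x
    by (simp add: W_def V_def)
  have V_Suc: "V (Suc t) x = gradient (f (x (s, Suc t))) (W (Suc t) x)
      - gradient (f (x (s, Suc t))) (W t x) + V t x" for t x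
    by (simp add: W_def V_def)
  have c_nonneg: "0 \<le> c t" for t
    unfolding c_def E_def by (intro mean_nonneg) simp
  have e0: "e 0 = 0"
    by (simp add: e_def E_def W_def V_def gradient_average mean_def)
  have e_Suc: "e (Suc t) \<le> e t + L\<^sup>2 * \<eta>\<^sup>2 * c t" if t: "Suc t \<le> m" for t
  proof -
    \<comment> \<open>Sample \<open>Suc t\<close> is first read by \<open>V (Suc t)\<close>, so
      redrawing it changes neither \<open>W t\<close> nor \<open>V t\<close>, and therefore not
      \<open>W (Suc t)\<close> either.\<close>
    have upd: "W t (x((s, Suc t) := j)) = W t x" "V t (x((s, Suc t) := j)) = V t x" for x j
      using t unfolding W_def V_def
      by (auto simp: u intro!: sarah_w_cong sarah_v_cong)
    then have W_upd: "W (Suc t) (x((s, Suc t) := j)) = W (Suc t) x" for x j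
      by (simp add: W_Suc)
    have "e (Suc t) = E (\<lambda>x. mean {1..n} (\<lambda>j. (norm (G (W (Suc t) x)
        - (gradient (f j) (W (Suc t) x) - gradient (f j) (W t x) + V t x)))\<^sup>2))"
      unfolding e_def E_def
      using \<open>finite K\<close> n_pos t s
      by (subst mean_PiE_resample[where k = "(s, Suc t)", symmetric]) (auto simp: V_Suc upd W_upd)
    also have "\<dots> \<le> E (\<lambda>x. (norm (G (W t x) - V t x))\<^sup>2 + L\<^sup>2 * (norm (W (Suc t) x - W t x))\<^sup>2)"
      unfolding E_def by (intro mean_mono mean_estimator_error)
    also have "\<dots> = E (\<lambda>x. (norm (G (W t x) - V t x))\<^sup>2 + (L\<^sup>2 * \<eta>\<^sup>2) * (norm (V t x))\<^sup>2)"
      by (simp add: W_Suc power_mult_distrib mult.assoc)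
    finally show ?thesis
      by (simp add: E_def mean_add mean_cmult e_def c_def)
  qed
  have e_le: "e t \<le> L\<^sup>2 * \<eta>\<^sup>2 * (\<Sum>r<t. c r)" if "t \<le> m" for t
    using that
  proof (induction t)
    case (Suc t)
    then show ?case using e_Suc[of t] by (simp add: distrib_left)
  qed (simp add: e0)
  \<comment> \<open>Dropping the vanishing term at 0 leaves \<open>m\<close> terms instead of
    \<open>m + 1\<close>, which gives exactly the factor \<open>m\<close> of the step size
    condition.\<close>
  have "sum e {0..m} = sum e {1..m}"
    by (simp add: e0 sum.atLeast_Suc_atMost)
  also have "\<dots> \<le> (\<Sum>t = 1..m. L\<^sup>2 * \<eta>\<^sup>2 * sum c {0..m})"
  proof (rule sum_mono)
    fix t assume t: "t \<in> {1..m}"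
    have "e t \<le> L\<^sup>2 * \<eta>\<^sup>2 * (\<Sum>r<t. c r)"
      using t by (intro e_le) simp
    also have "\<dots> \<le> L\<^sup>2 * \<eta>\<^sup>2 * sum c {0..m}"
      using t by (intro mult_left_mono sum_mono2) (auto simp: c_nonneg)
    finally show "e t \<le> L\<^sup>2 * \<eta>\<^sup>2 * sum c {0..m}" .
  qed
  also have "\<dots> = L\<^sup>2 * \<eta>\<^sup>2 * real m * sum c {0..m}"
    by simp
  also have "\<dots> \<le> (1 - L * \<eta>) * sum c {0..m}"
    using assms(5) c_nonneg by (intro mult_right_mono sum_nonneg) auto
  finally have error: "sum e {0..m} \<le> (1 - L * \<eta>) * sum c {0..m}" .
  have step: "E (\<lambda>x. F (W (Suc t) x))
      \<le> E (\<lambda>x. F (W t x)) - \<eta> / 2 * g t + \<eta> / 2 * e t - \<eta> / 2 * (1 - L * \<eta>) * c t" for t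
  proof -
    have "E (\<lambda>x. F (W (Suc t) x)) \<le> E (\<lambda>x. F (W t x) - \<eta> / 2 * (norm (G (W t x)))\<^sup>2
        + \<eta> / 2 * (norm (G (W t x) - V t x))\<^sup>2 - \<eta> / 2 * (1 - L * \<eta>) * (norm (V t x))\<^sup>2)"
      unfolding W_Suc E_def by (intro mean_mono step_descent)
    also have "\<dots> = E (\<lambda>x. F (W t x)) - \<eta> / 2 * g t + \<eta> / 2 * e t - \<eta> / 2 * (1 - L * \<eta>) * c t"
      unfolding E_def g_def e_def c_def by (simp only: mean_add mean_diff mean_cmult)
    finally show ?thesis .
  qed
  \<comment> \<open>\<open>step\<close> rests on pointwise descent alone, so the telescoping runs
    for every \<open>k\<close>; the choice \<open>k = m\<close> reaches the last iterate of the
    loop.\<close>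
  have "E (\<lambda>x. F (W (Suc k) x)) \<le> E (\<lambda>x. F (u x)) - \<eta> / 2 * sum g {0..k} + \<eta> / 2 * sum e {0..k}
      - \<eta> / 2 * (1 - L * \<eta>) * sum c {0..k}" for k
  proof (induction k)
    case 0
    show ?case using step[of 0] by (simp add: W_def)
  next
    case (Suc k)
    then show ?case using step[of "Suc k"] by (simp add: distrib_left)
  qed
  from this[of m] have "E (\<lambda>x. F (W (m + 1) x)) \<le> E (\<lambda>x. F (u x)) - \<eta> / 2 * sum g {0..m}
      + \<eta> / 2 * (sum e {0..m} - (1 - L * \<eta>) * sum c {0..m})"
    by (simp add: right_diff_distrib[of _ "sum e {0..m}"] diff_divide_distrib mult.assoc)
  moreover have "\<eta> / 2 * (sum e {0..m} - (1 - L * \<eta>) * sum c {0..m}) \<le> 0"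
    using \<open>0 < \<eta>\<close> error by (intro mult_nonneg_nonpos) auto
  ultimately show ?thesis
    by (simp add: g_def)
qed

text \<open>The last iterate of one loop is the start of the next, so the bounds telescope. All
  means run over the same table of \<open>S\<close> rows, which lets the bounds of different loops
  be added.\<close>

lemma sarah_mean_descent:
  assumes "S' \<le> S" and "0 < \<eta>" and "L\<^sup>2 * \<eta>\<^sup>2 * real m + L * \<eta> \<le> 1"
  defines "E \<equiv> mean (PiE ({1..S} \<times> {1..m}) (\<lambda>_. {1..n}))"
  shows "E (\<lambda>x. F (sarah_outer n f \<eta> m w0 (curry x) S'))
    \<le> F w0 - \<eta> / 2 * (\<Sum>s = 1..S'. \<Sum>t = 0..m.
        E (\<lambda>x. (norm (G (sarah_iterate n f \<eta> m w0 (curry x) s t)))\<^sup>2))"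
  using \<open>S' \<le> S\<close>
proof (induction S')
  case 0
  have "E (\<lambda>x. F w0) = F w0"
    using n_pos unfolding E_def by (intro mean_const finite_PiE) (auto simp: PiE_eq_empty_iff)
  then show ?case by simp
next
  case (Suc s)
  let ?u = "\<lambda>x. sarah_outer n f \<eta> m w0 (curry x) s"
  \<comment> \<open>The start \<open>?u x\<close> reads only rows 1 to \<open>s\<close>, hence is
    unaffected by changes in row \<open>Suc s\<close>; this is the independence that the inner loop
    asks for.\<close>
  have "E (\<lambda>x. F (sarah_w n f \<eta> (?u x) (\<lambda>r. x (Suc s, r)) (m + 1)))
      \<le> E (\<lambda>x. F (?u x)) - \<eta> / 2 * (\<Sum>t = 0..m.
        E (\<lambda>x. (norm (G (sarah_w n f \<eta> (?u x) (\<lambda>r. x (Suc s, r)) t)))\<^sup>2))"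
    unfolding E_def using assms Suc.prems
    by (intro sarah_inner_loop) (auto intro!: sarah_outer_cong)
  then show ?case
    using Suc by (simp add: sarah_iterate_def curry_def distrib_left del: sarah_w.simps)
qed

end

section \<open>From table means back to expectations\<close>

theorem theorem1:
  fixes M :: "'w measure"
    and f :: "nat \<Rightarrow> 'a::euclidean_space \<Rightarrow> real"
    and n m S :: nat
    and L \<eta> Fstar :: real
    and w0 :: 'a
    and I :: "nat \<Rightarrow> nat \<Rightarrow> 'w \<Rightarrow> nat"
  assumes "n \<ge> 1" and "S \<ge> 1"
    and "\<And>i w. i \<in> {1..n} \<Longrightarrow> f i differentiable (at w)"
    and "average_smooth n f L"
    and "\<And>w. Fstar \<le> average_fun n f w"
    and "0 < \<eta>" and "\<eta> \<le> 2 / (L * (sqrt (1 + 4 * real m) + 1))"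
    and "prob_space M"
    and "prob_space.indep_vars M (\<lambda>_. count_space UNIV) (\<lambda>(s, t). I s t) ({1..S} \<times> {1..m})"
    and "\<And>s t. s \<in> {1..S} \<Longrightarrow> t \<in> {1..m} \<Longrightarrow>
           distr M (count_space UNIV) (I s t) = measure_pmf (pmf_of_set {1..n})"
  shows "1 / (real (m + 1) * real S) *
           (\<Sum>s = 1..S. \<Sum>t = 0..m.
              prob_space.expectation M
                (\<lambda>\<omega>. (norm (gradient (average_fun n f)
                   (sarah_iterate n f \<eta> m w0 (\<lambda>s t. I s t \<omega>) s t)))\<^sup>2))
         \<le> 2 / (\<eta> * (real (m + 1) * real S)) * (average_fun n f w0 - Fstar)"
proof -
  interpret average_smooth_functions n f L
    using assms by unfold_locales auto
  let ?K = "{1..S} \<times> {1..m}"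
  let ?E = "mean (PiE ?K (\<lambda>_. {1..n}))"
  let ?g = "\<lambda>s t i. (norm (G (sarah_iterate n f \<eta> m w0 i s t)))\<^sup>2"
  have expect: "prob_space.expectation M (\<lambda>\<omega>. ?g s t (\<lambda>s t. I s t \<omega>)) = ?E (\<lambda>x. ?g s t (curry x))"
    if st: "s \<in> {1..S}" "t \<in> {0..m}" for s t
  proof -
    \<comment> \<open>Since \<open>t \<le> m\<close>, the iterate reads only entries in
      \<open>?K\<close>, so the undefined values of the restricted table outside \<open>?K\<close>
      never enter.\<close>
    have "?g s t (\<lambda>s t. I s t \<omega>) = ?g s t (curry (\<lambda>k\<in>?K. (case k of (s, t) \<Rightarrow> I s t) \<omega>))" for \<omega>
    proof -
      let ?i = "\<lambda>s t. I s t \<omega>" and ?j = "curry (\<lambda>k\<in>?K. (case k of (s, t) \<Rightarrow> I s t) \<omega>)"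
      have "sarah_outer n f \<eta> m w0 ?i (s - 1) = sarah_outer n f \<eta> m w0 ?j (s - 1)"
        using st by (intro sarah_outer_cong) auto
      moreover have "sarah_w n f \<eta> u (?i s) t = sarah_w n f \<eta> u (?j s) t" for u
        using st by (intro sarah_w_cong) auto
      ultimately show ?thesis
        by (simp add: sarah_iterate_def)
    qed
    then show ?thesis
      using assms
      by (simp only:) (intro expectation_indep_uniform[where \<Phi> = "\<lambda>x. ?g s t (curry x)"]; auto)
  qed
  have "Fstar = ?E (\<lambda>x. Fstar)"
    using \<open>n \<ge> 1\<close> by (intro mean_const[symmetric] finite_PiE) (auto simp: PiE_eq_empty_iff)
  also have "\<dots> \<le> ?E (\<lambda>x. F (sarah_outer n f \<eta> m w0 (curry x) S))"
    using assms by (intro mean_mono) auto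
  also have "\<dots> \<le> F w0 - \<eta> / 2 * (\<Sum>s = 1..S. \<Sum>t = 0..m. ?E (\<lambda>x. ?g s t (curry x)))"
    using assms L_pos by (intro sarah_mean_descent sarah_step_size) auto
  finally have "(\<Sum>s = 1..S. \<Sum>t = 0..m. ?E (\<lambda>x. ?g s t (curry x))) \<le> 2 / \<eta> * (F w0 - Fstar)"
    using \<open>0 < \<eta>\<close> by (simp add: field_simps)
  then have "1 / (real (m + 1) * real S) * (\<Sum>s = 1..S. \<Sum>t = 0..m. ?E (\<lambda>x. ?g s t (curry x)))
      \<le> 1 / (real (m + 1) * real S) * (2 / \<eta> * (F w0 - Fstar))"
    by (intro mult_left_mono) auto
  then show ?thesis
    by (simp add: expect mult.commute mult.left_commute)
qed

end
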